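(* Every compact metric space $X$ is set-self-Tietze. That is, for every closed subset $A \subseteq X$ and every upper semi-continuous set-valued function $f : A \to 2^X$, there exists an upper semi-continuous set-valued function $F : X \to 2^X$ such that $F(x) = f(x)$ for all $x \in A$.
   Context: For a topological space $Y$, $2^Y$ denotes the collection of non-empty closed subsets of $Y$. A set-valued function $f : Z \to 2^Y$ between topological spaces is upper semi-continuous (usc) if for every closed $C \subseteq Y$ the set $f^{-1}(C) = \{z \in Z : f(z) \cap C \neq \emptyset\}$ is closed in $Z$; equivalently, for every open $U \subseteq Y$ the set $\{z \in Z : f(z) \subseteq U\}$ is open in $Z$. Closed subsets $A \subseteq X$ carry the subspace topology. A topological space $X$ is set-self-Tietze if for every closed $A \subseteq X$ and every usc $f : A \to 2^X$ there exists a usc $F : X \to 2^X$ with $F|_A = f$. *)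

theory Defs
  imports "HOL-Analysis.Analysis"
begin

definition closed_hyperspace :: "'a topology \<Rightarrow> 'a set set" where
  "closed_hyperspace Y = {C. closedin Y C \<and> C \<noteq> {}}"

text \<open>
  A map \<open>Z \<rightarrow> 2\<^sup>Y\<close> is a total function of which only the values on \<open>topspace Z\<close> matter.
\<close>

definition usc_map :: "'a topology \<Rightarrow> 'b topology \<Rightarrow> ('a \<Rightarrow> 'b set) \<Rightarrow> bool" where
  "usc_map Z Y f \<longleftrightarrow>
     f \<in> topspace Z \<rightarrow> closed_hyperspace Y \<and>
     (\<forall>C. closedin Y C \<longrightarrow> closedin Z {z \<in> topspace Z. f z \<inter> C \<noteq> {}})"

definition set_self_Tietze :: "'a topology \<Rightarrow> bool" where
  "set_self_Tietze X \<longleftrightarrow>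
     (\<forall>A f. closedin X A \<and> usc_map (subtopology X A) X f \<longrightarrow>
        (\<exists>F. usc_map X X F \<and> (\<forall>x\<in>A. F x = f x)))"

end

theory Submission imports Defs begin

text \<open>
  The extension is \<open>F x = \<Union>(f ` P x)\<close>, where \<open>P x\<close> is the set of points of \<open>A\<close> at minimal
  distance from \<open>x\<close>. A point of \<open>A\<close> is its own unique nearest point, so \<open>F\<close> agrees with \<open>f\<close>
  on \<open>A\<close>. For single-valued maps this fails, because a nearest point cannot in general be chosen
  continuously; but the set of all nearest points varies
  upper semi-continuously as soon as \<open>A\<close> is compact and non-empty (\<open>usc_map_nearest_points\<close>), and for
  set-valued maps nothing has to be chosen. What remains is that upper semi-continuity survives
  composition (\<open>usc_map_compose\<close>). The preimages compose without further ado; the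
  values of the composite are closed because the values \<open>P x\<close> are compact and the target is
  regular (\<open>closedin_UN_usc_map_compactin\<close>).
  If \<open>A\<close> is empty, the constant map with the whole space as its value is an extension.
\<close>

lemma closedin_usc_map_value:
  assumes "usc_map Z Y f" "z \<in> topspace Z"
  shows "closedin Y (f z)"
  using assms unfolding usc_map_def closed_hyperspace_def by blast

lemma openin_usc_map_upper_preimage:
  assumes "usc_map Z Y f" "openin Y U"
  shows "openin Z {z \<in> topspace Z. f z \<subseteq> U}"
proof -
  have "{z \<in> topspace Z. f z \<subseteq> U}
      = topspace Z - {z \<in> topspace Z. f z \<inter> (topspace Y - U) \<noteq> {}}"
    using closedin_subset[OF closedin_usc_map_value[OF assms(1)]] by blast
  moreover have "closedin Z {z \<in> topspace Z. f z \<inter> (topspace Y - U) \<noteq> {}}"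
    using assms unfolding usc_map_def by blast
  ultimately show ?thesis
    by (simp only: openin_diff[OF openin_topspace])
qed

text \<open>
  The argument is the one that separates a compact set from a point outside it: for \<open>y\<close> outside
  the union, regularity separates \<open>y\<close> from each value \<open>f k\<close>, upper semi-continuity makes the
  separation work for all points near \<open>k\<close>, and finitely many such neighbourhoods cover \<open>K\<close>.
\<close>

lemma closedin_UN_usc_map_compactin:
  assumes f: "usc_map W Y f" and Y: "regular_space Y" and K: "compactin W K"
  shows "closedin Y (\<Union>(f ` K))"
proof -
  have val: "closedin Y (f k)" if "k \<in> K" for k
    using closedin_usc_map_value[OF f] compactin_subset_topspace[OF K] that by blast
  have "\<exists>T. openin Y T \<and> y \<in> T \<and> T \<subseteq> topspace Y - \<Union>(f ` K)"
    if y: "y \<in> topspace Y - \<Union>(f ` K)" for y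
  proof -
    have "\<forall>k\<in>K. \<exists>U V. openin Y U \<and> openin Y V \<and> y \<in> U \<and> f k \<subseteq> V \<and> disjnt U V"
      using Y val y unfolding regular_space_def by fastforce
    then obtain U V where UV:
      "\<And>k. k \<in> K \<Longrightarrow> openin Y (U k) \<and> openin Y (V k) \<and> y \<in> U k \<and> f k \<subseteq> V k \<and> disjnt (U k) (V k)"
      by metis
    define N where "N k = {w \<in> topspace W. f w \<subseteq> V k}" for k
    have "\<And>k. k \<in> K \<Longrightarrow> openin W (N k)"
      unfolding N_def using UV f openin_usc_map_upper_preimage by blast
    moreover have "K \<subseteq> \<Union>(N ` K)"
      using UV compactin_subset_topspace[OF K] unfolding N_def by blast
    ultimately obtain \<F> where "finite \<F>" "\<F> \<subseteq> N ` K" "K \<subseteq> \<Union>\<F>"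
      using K unfolding compactin_def by (metis (no_types, lifting) imageE)
    then obtain J where J: "finite J" "J \<subseteq> K" "K \<subseteq> \<Union>(N ` J)"
      by (metis finite_subset_image)
    \<comment> \<open>The extra factor \<open>topspace Y\<close> takes care of \<open>J = {}\<close>, that is, of \<open>K = {}\<close>.\<close>
    define T where "T = topspace Y \<inter> \<Inter>(U ` J)"
    have "openin Y T"
      unfolding T_def using J UV
      by (cases "J = {}") (auto intro!: openin_Int openin_Inter)
    moreover have "y \<in> T"
      using y J UV unfolding T_def by blast
    moreover have "T \<inter> f k = {}" if k: "k \<in> K" for k
    proof -
      obtain j where j: "j \<in> J" "k \<in> N j" using J k by blast
      then have "f k \<subseteq> V j" "T \<subseteq> U j" "disjnt (U j) (V j)"
        using UV J unfolding N_def T_def by blast+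
      then show ?thesis unfolding disjnt_def by blast
    qed
    ultimately show ?thesis
      unfolding T_def by blast
  qed
  then have "openin Y (topspace Y - \<Union>(f ` K))"
    by (meson openin_subopen)
  then show ?thesis
    unfolding closedin_def using closedin_subset[OF val] by blast
qed

lemma usc_map_compose:
  assumes P: "usc_map Z W P" and cpt: "\<And>z. z \<in> topspace Z \<Longrightarrow> compactin W (P z)"
    and f: "usc_map W Y f" and Y: "regular_space Y"
  shows "usc_map Z Y (\<lambda>z. \<Union>(f ` P z))"
  unfolding usc_map_def
proof (intro conjI allI impI funcsetI)
  fix z assume z: "z \<in> topspace Z"
  obtain w where "w \<in> P z" "w \<in> topspace W"
    using P z compactin_subset_topspace[OF cpt[OF z]]
    unfolding usc_map_def closed_hyperspace_def by blast
  then have "\<Union>(f ` P z) \<noteq> {}"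
    using f unfolding usc_map_def closed_hyperspace_def by blast
  then show "\<Union>(f ` P z) \<in> closed_hyperspace Y"
    using closedin_UN_usc_map_compactin[OF f Y cpt[OF z]]
    unfolding closed_hyperspace_def by simp
next
  fix C assume C: "closedin Y C"
  have "closedin W {w \<in> topspace W. f w \<inter> C \<noteq> {}}"
    using f C unfolding usc_map_def by blast
  then have "closedin Z {z \<in> topspace Z. P z \<inter> {w \<in> topspace W. f w \<inter> C \<noteq> {}} \<noteq> {}}"
    using P unfolding usc_map_def by blast
  moreover have "{z \<in> topspace Z. P z \<inter> {w \<in> topspace W. f w \<inter> C \<noteq> {}} \<noteq> {}}
      = {z \<in> topspace Z. \<Union>(f ` P z) \<inter> C \<noteq> {}}"
    using cpt[THEN compactin_subset_topspace] by blast
  ultimately show "closedin Z {z \<in> topspace Z. \<Union>(f ` P z) \<inter> C \<noteq> {}}"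
    by simp
qed

definition nearest_points :: "('a \<Rightarrow> 'a \<Rightarrow> real) \<Rightarrow> 'a set \<Rightarrow> 'a \<Rightarrow> 'a set" where
  "nearest_points d A x = {a \<in> A. \<forall>b\<in>A. d x a \<le> d x b}"

context Metric_space
begin

lemma continuous_map_dist:
  assumes "continuous_map X mtopology f" "continuous_map X mtopology g"
  shows "continuous_map X euclideanreal (\<lambda>x. d (f x) (g x))"
  using continuous_map_mdist[of X "metric (M,d)" f g] assms by (simp add: mtopology_of)

lemma nearest_points_self:
  assumes "A \<subseteq> M" "x \<in> A"
  shows "nearest_points d A x = {x}"
proof -
  have "y = x" if "y \<in> A" "d x y \<le> d x x" for y
  proof -
    have "x \<in> M" "y \<in> M" using assms that by auto
    moreover from this have "d x y = 0"
      using that(2) nonneg[of x y] by (simp add: mdist_zero)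
    ultimately show ?thesis by simp
  qed
  moreover have "d x x \<le> d x y" for y
  proof -
    have "x \<in> M" using assms by blast
    then show ?thesis by (simp add: mdist_zero)
  qed
  ultimately show ?thesis
    using assms(2) unfolding nearest_points_def by blast
qed

lemma nearest_points_nonempty:
  assumes "compactin mtopology A" "A \<noteq> {}" "x \<in> M"
  shows "nearest_points d A x \<noteq> {}"
proof -
  have "continuous_map mtopology euclideanreal (d x)"
    using assms(3) by (intro continuous_map_dist) auto
  then have "compact (d x ` A)"
    using image_compactin[OF assms(1)] by fastforce
  then obtain s where "s \<in> d x ` A" "\<forall>t \<in> d x ` A. s \<le> t"
    using compact_attains_inf[of "d x ` A"] assms(2) by blast
  then show ?thesis
    unfolding nearest_points_def by blast
qed

text \<open>
  Being a nearest point is a closed condition on pairs, by continuity of the distance. The points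
  that have a nearest point in a closed set are the projection of a closed set of pairs, and
  projecting along a compact factor preserves closedness.
\<close>

lemma usc_map_nearest_points:
  assumes A: "compactin mtopology A" and ne: "A \<noteq> {}"
  shows "usc_map mtopology (subtopology mtopology A) (nearest_points d A)"
proof -
  let ?A = "subtopology mtopology A"
  let ?Q = "prod_topology mtopology ?A"
  have AM: "A \<subseteq> M" using compactin_subset_topspace[OF A] by simp
  then have top: "topspace ?A = A" by auto
  define G where "G = {p \<in> topspace ?Q. snd p \<in> nearest_points d A (fst p)}"
  have fst_cont: "continuous_map ?Q mtopology fst" and snd_cont: "continuous_map ?Q mtopology snd"
    using continuous_map_fst continuous_map_snd continuous_map_in_subtopology by blast+
  have G_closed: "closedin ?Q G"
  proof -
    have "closedin ?Q {p \<in> topspace ?Q. d (fst p) (snd p) - d (fst p) b \<in> {..0}}" if "b \<in> A" for b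
    proof (rule closedin_continuous_map_preimage)
      show "continuous_map ?Q euclideanreal (\<lambda>p. d (fst p) (snd p) - d (fst p) b)"
        using that AM fst_cont snd_cont by (intro continuous_map_diff continuous_map_dist) auto
    qed simp
    then have "closedin ?Q (\<Inter>b\<in>A. {p \<in> topspace ?Q. d (fst p) (snd p) - d (fst p) b \<in> {..0}})"
      using ne by (intro closedin_Inter) auto
    moreover have "(\<Inter>b\<in>A. {p \<in> topspace ?Q. d (fst p) (snd p) - d (fst p) b \<in> {..0}}) = G"
      using ne unfolding G_def nearest_points_def by auto
    ultimately show ?thesis by simp
  qed
  show ?thesis
    unfolding usc_map_def
  proof (intro conjI allI impI funcsetI)
    fix x assume "x \<in> topspace mtopology"
    then have x: "x \<in> M" by simp
    have "continuous_map ?A ?Q (\<lambda>a. (x, a))"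
      using x by (simp add: continuous_map_paired)
    then have "closedin ?A {a \<in> topspace ?A. (x, a) \<in> G}"
      using G_closed by (rule closedin_continuous_map_preimage)
    moreover have "{a \<in> topspace ?A. (x, a) \<in> G} = nearest_points d A x"
      using x top unfolding G_def nearest_points_def by auto
    ultimately show "nearest_points d A x \<in> closed_hyperspace ?A"
      using nearest_points_nonempty[OF A ne x] unfolding closed_hyperspace_def by simp
  next
    fix C assume C: "closedin ?A C"
    have "closedin ?Q (G \<inter> {p \<in> topspace ?Q. snd p \<in> C})"
      using G_closed closedin_continuous_map_preimage[OF continuous_map_snd C] by blast
    then have "closedin mtopology (fst ` (G \<inter> {p \<in> topspace ?Q. snd p \<in> C}))"
      using Abstract_Topological_Spaces.closed_map_fst[OF compact_space_subtopology[OF A]]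
      unfolding closed_map_def by blast
    moreover have "fst ` (G \<inter> {p \<in> topspace ?Q. snd p \<in> C})
        = {x \<in> topspace mtopology. nearest_points d A x \<inter> C \<noteq> {}}"
    proof (intro subset_antisym subsetI)
      fix x assume "x \<in> {x \<in> topspace mtopology. nearest_points d A x \<inter> C \<noteq> {}}"
      then obtain a where "x \<in> M" "a \<in> nearest_points d A x" "a \<in> C" by auto
      then have "(x, a) \<in> G \<inter> {p \<in> topspace ?Q. snd p \<in> C}"
        using top unfolding G_def nearest_points_def by simp
      then show "x \<in> fst ` (G \<inter> {p \<in> topspace ?Q. snd p \<in> C})"
        by (rule image_eqI[rotated]) simp
    qed (auto simp: G_def)
    ultimately show "closedin mtopology {x \<in> topspace mtopology. nearest_points d A x \<inter> C \<noteq> {}}"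
      by simp
  qed
qed

end

theorem theoremA:
  fixes M :: "'a set" and d :: "'a \<Rightarrow> 'a \<Rightarrow> real"
  assumes "Metric_space M d"
    and "compact_space (Metric_space.mtopology M d)"
  shows "set_self_Tietze (Metric_space.mtopology M d)"
proof -
  interpret Metric_space M d by fact
  show ?thesis
    unfolding set_self_Tietze_def
  proof (intro allI impI)
    fix A f
    assume *: "closedin mtopology A \<and> usc_map (subtopology mtopology A) mtopology f"
    then have A: "compactin mtopology A" and AM: "A \<subseteq> M"
      and f: "usc_map (subtopology mtopology A) mtopology f"
      using assms(2) closedin_compact_space closedin_subset by fastforce+
    show "\<exists>F. usc_map mtopology mtopology F \<and> (\<forall>x\<in>A. F x = f x)"
    proof (cases "A = {}")
      case True
      have "usc_map mtopology mtopology (\<lambda>x. M)"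
        unfolding usc_map_def closed_hyperspace_def
      proof (intro conjI allI impI)
        fix C assume "closedin mtopology C"
        show "closedin mtopology {z \<in> topspace mtopology. M \<inter> C \<noteq> {}}"
          by (cases "M \<inter> C = {}") auto
      qed auto
      then show ?thesis using True by blast
    next
      case False
      let ?P = "nearest_points d A"
      have P: "usc_map mtopology (subtopology mtopology A) ?P"
        using A False by (rule usc_map_nearest_points)
      have "compactin (subtopology mtopology A) (?P x)" if "x \<in> topspace mtopology" for x
        using P that closedin_compact_space[OF compact_space_subtopology[OF A]]
        unfolding usc_map_def closed_hyperspace_def by blast
      then have "usc_map mtopology mtopology (\<lambda>x. \<Union>(f ` ?P x))"
        using P f regular_space_mtopology by (intro usc_map_compose)
      then show ?thesis
        using nearest_points_self[OF AM] by (intro exI[of _ "\<lambda>x. \<Union>(f ` ?P x)"]) simp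
    qed
  qed
qed

end
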